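(* Let $k\in\mathbb C$ with $\Re(k)>0$ and $\delta>0$. Let $f:\mathbb Q\to\mathbb C$ satisfy $f(x)=f(x+1)$ for all $x\in\mathbb Q\setminus[-1,0]$, and let $h:\mathbb R\setminus\{0\}\to\mathbb C$ satisfy $h(x)=f(x)-|x|^{-k}f(-1/x)$ for $x\in\mathbb Q\setminus\{0\}$, with $h(x)\ll e^{|x|^{-1+\delta}}$ for $x\in(-1,1)\setminus\{0\}$. Then the limit $$f^\ast(x):=\lim_{j\to\infty}q(x_{2j+1})^{-k}f\big(\overline{x_{2j+1}}\big)$$ exists for all $x$ in a subset $X\subset\mathbb R$ of full Lebesgue measure, where $x_{2j+1}=[b_0(x);b_1(x),\dots,b_{2j+1}(x)]$ is the $(2j+1)$-th continued fraction convergent of $x$ and $q(y)$ denotes the denominator of a rational $y$. Moreover, if additionally $f$ is $1$-periodic on all of $\mathbb Q$ and $h(x)=O(|x|^{-\Re(k)})$ for $0<|x|\leq1$, then on $X\setminus\mathbb Q$ this limit coincides with $\lim_{\mathbb Q\ni y=a/q\to x}q^{-k}f(\overline y)$.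
   Context: For a rational $y=a/q$ in reduced form with $q\ge1$, $\overline{y}:=\overline{a}_q/q$ where $\overline a_q\in(0,q]$ satisfies $a\overline a_q\equiv1\pmod q$. $x=[b_0;b_1,b_2,\dots]$ denotes the regular continued fraction expansion. *)

theory Defs
  imports "HOL-Analysis.Analysis"
begin

fun cf_rem :: "real \<Rightarrow> nat \<Rightarrow> real" where
  "cf_rem x 0 = x"
| "cf_rem x (Suc n) = 1 / frac (cf_rem x n)"

definition cf_digit :: "real \<Rightarrow> nat \<Rightarrow> int" where
  "cf_digit x n = \<lfloor>cf_rem x n\<rfloor>"

fun cf_val :: "(nat \<Rightarrow> int) \<Rightarrow> nat \<Rightarrow> rat" where
  "cf_val b 0 = of_int (b 0)"
| "cf_val b (Suc n) = of_int (b 0) + 1 / cf_val (\<lambda>i. b (Suc i)) n"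

definition cf_conv :: "real \<Rightarrow> nat \<Rightarrow> rat" where
  "cf_conv x n = cf_val (cf_digit x) n"

definition rat_den :: "rat \<Rightarrow> int" where
  "rat_den y = snd (quotient_of y)"

definition rat_bar :: "rat \<Rightarrow> rat" where
  "rat_bar y = (case quotient_of y of (a, q) \<Rightarrow>
      of_int (THE c. 0 < c \<and> c \<le> q \<and> (a * c) mod q = 1 mod q) / of_int q)"

definition fstar_term :: "complex \<Rightarrow> (rat \<Rightarrow> complex) \<Rightarrow> rat \<Rightarrow> complex" where
  "fstar_term k f y = (of_int (rat_den y)) powr (- k) * f (rat_bar y)"

end

(*
  Write q_n for the denominators of the convergents of x. Since the inverse of p_n modulo q_n is
  (-1)^(n-1) q_{n-1}, the quantities T_n = q_n^(-k) f((-1)^(n-1) q_{n-1}/q_n) agree for odd n with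
  the terms of the limit, and the reciprocity relation gives
  T_n - T_{n-1} = q_n^(-k) h((-1)^(n-1) q_{n-1}/q_n).
  We may assume delta < 1. By Borel-Cantelli over all rationals,
  q_n/q_{n-1} <= (1 + log q_{n-1})^(1+delta) for almost every x and all large n, so that these differences are O(q_{n-1}^(-Re k/2)) and summable.

  If f is 1-periodic and h(x) = O(|x|^(-Re k)), then the same relation bounds the change of the term
  between Farey neighbours p/q and P/Q, q <= Q, by O(q^(-Re k)). A rational y close to x lies in a
  cylinder of x, so Euclid's algorithm leads from p_n/q_n to y through Farey neighbours whose
  denominators at least double every two steps; the total change is O(q_n^(-Re k)).
*)
theory Submission
  imports Defs "HOL-Number_Theory.Cong" "HOL-Real_Asymp.Real_Asymp"
begin

section \<open>Terms at Farey neighbours\<close>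

lemma quotient_of_coprime_divide:
  assumes "coprime p q" "0 < q"
  shows "quotient_of (of_int p / of_int q) = (p, q)"
  using assms by (simp add: Fract_of_int_quotient [symmetric] quotient_of_Fract normalize_stable)

lemma rat_den_divide:
  assumes "coprime p q" "0 < q"
  shows "rat_den (of_int p / of_int q) = q"
  using quotient_of_coprime_divide[OF assms] by (simp add: rat_den_def)

lemma rat_bar_divide:
  assumes pq: "coprime p q" "0 < q" and c: "0 < c" "c \<le> q" "[p * c = 1] (mod q)"
  shows "rat_bar (of_int p / of_int q) = of_int c / of_int q"
proof -
  have "(THE d. 0 < d \<and> d \<le> q \<and> (p * d) mod q = 1 mod q) = c"
  proof (rule the_equality)
    show "0 < c \<and> c \<le> q \<and> p * c mod q = 1 mod q"
      using c by (simp add: cong_def)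
    fix d assume d: "0 < d \<and> d \<le> q \<and> p * d mod q = 1 mod q"
    then have "[p * d = p * c] (mod q)" using c by (simp add: cong_def)
    then have "[d = c] (mod q)" using pq(1) by (simp add: cong_mult_lcancel)
    \<comment> \<open>Subtracting 1 moves the range \<open>(0, q]\<close> to \<open>[0, q)\<close>,
      where congruent numbers are equal.\<close>
    then have "[d - 1 = c - 1] (mod q)" by (simp add: cong_diff)
    then show "d = c" using c d by (simp add: cong_def)
  qed
  then show ?thesis using quotient_of_coprime_divide[OF pq] by (simp add: rat_bar_def)
qed

lemma fstar_term_divide:
  assumes "coprime p q" "0 < q" "0 < c" "c \<le> q" "[p * c = 1] (mod q)"
  shows "fstar_term k f (of_int p / of_int q) = of_int q powr (- k) * f (of_int c / of_int q)"
  using assms by (simp add: fstar_term_def rat_den_divide rat_bar_divide)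

lemma periodic_add_of_int:
  fixes f :: "rat \<Rightarrow> 'a"
  assumes per: "\<And>x. f (x + 1) = f x"
  shows "f (x + of_int n) = f x"
proof (induction n rule: int_induct[where k = 0])
  case (step1 i)
  then show ?case using per[of "x + of_int i"] by (simp add: add.assoc)
next
  case (step2 i)
  then show ?case using per[of "x + of_int (i - 1)"] by (simp add: add.assoc)
qed simp

text \<open>Under full periodicity any inverse of \<open>p\<close> modulo \<open>q\<close>, even a
  negative one, may stand for the reduced one. This freedom lets both inverses at a pair of Farey
  neighbours be written down explicitly.\<close>

lemma fstar_term_periodic:
  assumes per: "\<And>x. f (x + 1) = f x"
    and pq: "coprime p q" "0 < q" and c: "[p * c = 1] (mod q)"
  shows "fstar_term k f (of_int p / of_int q) = of_int q powr (- k) * f (of_int c / of_int q)"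
proof -
  define d where "d = (c - 1) mod q + 1"
  have d: "d = c - q * ((c - 1) div q)"
    using mult_div_mod_eq[of q "c - 1"] unfolding d_def by linarith
  have "[d = c] (mod q)" unfolding d by (simp add: cong_iff_dvd_diff)
  then have "[p * d = 1] (mod q)"
    using c by (metis cong_scalar_left cong_trans)
  moreover have "0 < d" "d \<le> q" using pq(2) pos_mod_sign[of q "c - 1"] pos_mod_bound[of q "c - 1"]
    unfolding d_def by linarith+
  moreover have "of_int c / of_int q = (of_int d / of_int q :: rat) + of_int ((c - 1) div q)"
    using pq(2) by (simp add: d field_simps)
  then have "f (of_int c / of_int q) = f (of_int d / of_int q)"
    using periodic_add_of_int[of f, OF per] by metis
  ultimately show ?thesis using fstar_term_divide[OF pq] by metis
qed

lemma norm_of_int_powr: "0 < q \<Longrightarrow> norm (of_int q powr z :: complex) = of_int q powr Re z"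
  using norm_powr_real_powr[of "of_int q" z] by simp

text \<open>At \<open>x = s * q / Q\<close> the factor \<open>Q powr (- k)\<close> turns
  \<open>\<bar>x\<bar> powr (- k)\<close> into \<open>q powr (- k)\<close>, and
  \<open>- 1 / x\<close> is \<open>- (s * Q) / q\<close>, as \<open>s\<close> is its own inverse.
  Both terms then have the shape of a term of the limit.\<close>

lemma reciprocity_scaled:
  fixes k :: complex and h :: "real \<Rightarrow> complex"
  assumes h_rel: "\<And>x::rat. x \<noteq> 0 \<Longrightarrow>
        h (of_rat x) = f x - (complex_of_real \<bar>of_rat x\<bar>) powr (- k) * f (- 1 / x)"
    and q: "0 < q" and Q: "0 < Q" and s: "\<bar>s\<bar> = 1"
  shows "of_int Q powr (- k) * f (of_int (s * q) / of_int Q)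
       - of_int q powr (- k) * f (- of_int (s * Q) / of_int q)
       = of_int Q powr (- k) * h (of_int (s * q) / of_int Q)"
proof -
  have s2: "s = 1 \<or> s = -1" using s by linarith
  define x :: rat where "x = of_int (s * q) / of_int Q"
  have x0: "x \<noteq> 0" using q Q s by (auto simp: x_def)
  have inv: "- 1 / x = - of_int (s * Q) / of_int q"
    using s2 q Q by (auto simp: x_def field_simps)
  have ax: "\<bar>of_rat x\<bar> = (of_int q / of_int Q :: real)"
    using s2 q Q by (auto simp: x_def of_rat_divide of_rat_minus)
  have "of_int Q powr (- k) * complex_of_real \<bar>of_rat x\<bar> powr (- k) = of_int q powr (- k)"
    using q Q unfolding ax
    by (subst powr_times_real[symmetric]) auto
  then have "of_int Q powr (- k) * h (of_rat x)
      = of_int Q powr (- k) * f x - of_int q powr (- k) * f (- 1 / x)"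
    unfolding h_rel[OF x0] by (simp add: right_diff_distrib mult.assoc[symmetric])
  moreover have "of_rat x = (of_int (s * q) / of_int Q :: real)"
    by (simp add: x_def of_rat_divide of_rat_mult)
  ultimately show ?thesis unfolding inv by (metis x_def)
qed

lemma det_unit_coprime:
  fixes p q P Q :: int
  assumes "\<bar>P * q - p * Q\<bar> = 1"
  shows "coprime P Q" "coprime p q"
proof -
  have "d dvd P * q - p * Q \<Longrightarrow> is_unit d" for d :: int
    using assms by (metis dvd_abs_iff)
  then show "coprime P Q" "coprime p q" by (auto intro!: coprimeI)
qed

text \<open>With \<open>s\<close> the determinant, \<open>s * q\<close> inverts \<open>P\<close>
  modulo \<open>Q\<close> and \<open>- (s * Q)\<close> inverts \<open>p\<close> modulo
  \<open>q\<close>. The two terms are therefore the two sides of the scaled reciprocity relation,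
  and in the bound on \<open>h\<close> the powers of \<open>Q\<close> cancel.\<close>

lemma fstar_term_Farey_neighbours:
  fixes k :: complex and h :: "real \<Rightarrow> complex"
  assumes h_rel: "\<And>x::rat. x \<noteq> 0 \<Longrightarrow>
        h (of_rat x) = f x - (complex_of_real \<bar>of_rat x\<bar>) powr (- k) * f (- 1 / x)"
    and per: "\<And>x. f (x + 1) = f x"
    and hO: "\<And>x::real. 0 < \<bar>x\<bar> \<Longrightarrow> \<bar>x\<bar> \<le> 1 \<Longrightarrow> norm (h x) \<le> C * \<bar>x\<bar> powr (- Re k)"
    and q: "0 < q" "q \<le> Q" and det: "\<bar>P * q - p * Q\<bar> = 1"
  shows "norm (fstar_term k f (of_int P / of_int Q) - fstar_term k f (of_int p / of_int q))
       \<le> C * of_int q powr (- Re k)"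
proof -
  define s where "s = P * q - p * Q"
  have s: "\<bar>s\<bar> = 1" and ss: "s * s = 1"
    using det by (simp_all add: s_def) (metis abs_mult_self_eq mult_1)
  note cop = det_unit_coprime[OF det]
  have Q: "0 < Q" using q by simp
  have "P * (s * q) - 1 = Q * (p * s)" using ss by (simp add: s_def algebra_simps)
  then have "[P * (s * q) = 1] (mod Q)" by (simp add: cong_iff_dvd_diff)
  from fstar_term_periodic[of f, OF per cop(1) Q this]
  have 1: "fstar_term k f (of_int P / of_int Q) = of_int Q powr (- k) * f (of_int (s * q) / of_int Q)" .
  have "p * (- (s * Q)) - 1 = q * (- (P * s))" using ss by (simp add: s_def algebra_simps)
  then have "[p * (- (s * Q)) = 1] (mod q)" by (simp add: cong_iff_dvd_diff del: mult_minus_right)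
  from fstar_term_periodic[of f, OF per cop(2) q(1) this]
  have 2: "fstar_term k f (of_int p / of_int q) = of_int q powr (- k) * f (- of_int (s * Q) / of_int q)"
    by simp
  define x :: real where "x = of_int (s * q) / of_int Q"
  have ax: "\<bar>x\<bar> = of_int q / of_int Q" using s q by (simp add: x_def abs_mult flip: of_int_abs)
  have "norm (h x) \<le> C * \<bar>x\<bar> powr (- Re k)"
    by (rule hO) (use ax q in auto)
  then have "norm (of_int Q powr (- k) * h x) \<le> of_int Q powr (- Re k) * (C * \<bar>x\<bar> powr (- Re k))"
    by (simp add: norm_mult norm_of_int_powr[OF Q] mult_left_mono)
  also have "\<dots> = C * of_int q powr (- Re k)"
    using q by (simp add: ax powr_divide)
  finally show ?thesis
    using reciprocity_scaled[of h f k, OF h_rel q(1) Q s] by (simp add: 1 2 x_def)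
qed

text \<open>The two-term bound is what the induction along Euclid's algorithm reproduces: a step replaces
  \<open>(q, q')\<close> by \<open>(Q, q)\<close> with \<open>Q \<ge> q + q'\<close> and \<open>Q + q \<ge> 2 q\<close>, and \<open>K = C / (1 - 2 powr (- Re k))\<close> solves
  \<open>C + K * 2 powr (- Re k) = K\<close>.\<close>
lemma fstar_term_chain_bound:
  fixes k :: complex and h :: "real \<Rightarrow> complex"
  assumes h_rel: "\<And>x::rat. x \<noteq> 0 \<Longrightarrow>
        h (of_rat x) = f x - (complex_of_real \<bar>of_rat x\<bar>) powr (- k) * f (- 1 / x)"
    and per: "\<And>x. f (x + 1) = f x"
    and hO: "\<And>x::real. 0 < \<bar>x\<bar> \<Longrightarrow> \<bar>x\<bar> \<le> 1 \<Longrightarrow> norm (h x) \<le> C * \<bar>x\<bar> powr (- Re k)"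
    and k: "0 < Re k" and C: "0 \<le> C"
    and "0 < q" "0 \<le> q'" "q' \<le> q" "\<bar>p * q' - p' * q\<bar> = 1"
    and "coprime u v" "0 < v" "v \<le> u"
  shows "norm (fstar_term k f (of_int (p * u + p' * v) / of_int (q * u + q' * v))
             - fstar_term k f (of_int p / of_int q))
       \<le> C / (1 - 2 powr (- Re k)) * (of_int q powr (- Re k) + of_int (q + q') powr (- Re k))"
  using assms(6-)
proof (induction "nat v" arbitrary: u v p p' q q' rule: less_induct)
  case (less v u p p' q q')
  define \<sigma> where "\<sigma> = Re k"
  define K where "K = C / (1 - 2 powr (- \<sigma>))"
  have lt1: "2 powr (- \<sigma>) < 1" using k by (simp add: \<sigma>_def powr_less_one)
  have K0: "0 \<le> K" using C lt1 by (simp add: K_def)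
  have CK: "C + K * 2 powr (- \<sigma>) = K" 
  proof -
    have "K * (1 - 2 powr (- \<sigma>)) = C"
      using k by (simp add: K_def \<sigma>_def)
    then show ?thesis by (simp add: algebra_simps)
  qed
  have CleK: "C \<le> K" using CK K0 by (metis le_add_same_cancel1 mult_nonneg_nonneg powr_ge_zero)
  \<comment> \<open>One step of Euclid's algorithm on \<open>(u, v)\<close>: the pair becomes
    \<open>(v, w)\<close>, and the neighbours \<open>p/q\<close>, \<open>p'/q'\<close> become
    \<open>P/Q\<close>, \<open>p/q\<close>.\<close>
  define b w where "b = u div v" and "w = u mod v"
  have u: "u = b * v + w" and w: "0 \<le> w" "w < v" using less.prems by (simp_all add: b_def w_def)
  have b: "1 \<le> b" using less.prems by (simp add: b_def pos_imp_zdiv_pos_iff int_one_le_iff_zero_less)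
  define P Q where "P = p * b + p'" and "Q = q * b + q'"
  have Qge: "q + q' \<le> Q" using b less.prems by (simp add: Q_def)
  have det: "\<bar>P * q - p * Q\<bar> = 1"
    using less.prems(4) by (simp add: P_def Q_def algebra_simps abs_minus_commute)
  have step: "norm (fstar_term k f (of_int P / of_int Q) - fstar_term k f (of_int p / of_int q))
       \<le> C * of_int q powr (- \<sigma>)"
    unfolding \<sigma>_def
    by (rule fstar_term_Farey_neighbours[of h f k, OF h_rel per hO _ _ det])
       (use less.prems Qge in auto)
  have num: "p * u + p' * v = P * v + p * w" and den: "q * u + q' * v = Q * v + q * w"
    by (simp_all add: u P_def Q_def algebra_simps)
  show ?case
  proof (cases "w = 0")
    \<comment> \<open>Coprimality forces \<open>v = 1\<close>, so the target fraction is
      \<open>P/Q\<close> itself and one neighbour step suffices.\<close>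
    case True
    then have "v dvd u" by (simp add: u)
    then have "v = 1" using less.prems by (metis coprime_absorb_right abs_of_pos zdvd1_eq)
    then have "norm (fstar_term k f (of_int (p * u + p' * v) / of_int (q * u + q' * v))
             - fstar_term k f (of_int p / of_int q)) \<le> C * of_int q powr (- \<sigma>)"
      using step True unfolding num den by simp
    also have "\<dots> \<le> K * (of_int q powr (- \<sigma>) + of_int (q + q') powr (- \<sigma>))"
      by (intro mult_mono CleK K0) auto
    finally show ?thesis by (simp add: K_def \<sigma>_def)
  next
    case False
    with w have w: "0 < w" "w < v" by auto
    have IH: "norm (fstar_term k f (of_int (P * v + p * w) / of_int (Q * v + q * w))
             - fstar_term k f (of_int P / of_int Q))
       \<le> K * (of_int Q powr (- \<sigma>) + of_int (Q + q) powr (- \<sigma>))"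
      unfolding K_def \<sigma>_def
    proof (rule less.hyps)
      show "nat w < nat v" using w by simp
      show "coprime v w" using less.prems(5) w by (simp add: w_def coprime_commute)
    qed (use w det Qge less.prems in auto)
    have 1: "of_int Q powr (- \<sigma>) \<le> (of_int (q + q') powr (- \<sigma>) :: real)"
      using Qge less.prems k by (intro powr_mono2') (auto simp: \<sigma>_def simp flip: of_int_add)
    have "of_int (Q + q) powr (- \<sigma>) \<le> ((2 * of_int q) powr (- \<sigma>) :: real)"
      using Qge less.prems k by (intro powr_mono2') (auto simp: \<sigma>_def simp flip: of_int_add)
    also have "\<dots> = 2 powr (- \<sigma>) * of_int q powr (- \<sigma>)"
      using less.prems by (simp add: powr_mult)
    finally have 2: "of_int (Q + q) powr (- \<sigma>) \<le> (2 powr (- \<sigma>) * of_int q powr (- \<sigma>) :: real)" .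
    have "norm (fstar_term k f (of_int (p * u + p' * v) / of_int (q * u + q' * v))
             - fstar_term k f (of_int p / of_int q))
        \<le> C * of_int q powr (- \<sigma>) + K * (of_int Q powr (- \<sigma>) + of_int (Q + q) powr (- \<sigma>))"
      unfolding num den using norm_diff_triangle_le[OF IH step] by (simp only: add.commute)
    also have "\<dots> \<le> C * of_int q powr (- \<sigma>)
        + K * (of_int (q + q') powr (- \<sigma>) + 2 powr (- \<sigma>) * of_int q powr (- \<sigma>))"
      by (intro add_left_mono mult_left_mono add_mono 1 2 K0)
    also have "\<dots> = (C + K * 2 powr (- \<sigma>)) * of_int q powr (- \<sigma>) + K * of_int (q + q') powr (- \<sigma>)"
      by (simp add: algebra_simps)
    also have "\<dots> = K * (of_int q powr (- \<sigma>) + of_int (q + q') powr (- \<sigma>))"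
      unfolding CK by (simp add: algebra_simps)
    finally show ?thesis by (simp add: K_def \<sigma>_def)
  qed
qed

section \<open>Continued fractions of irrational numbers\<close>

text \<open>Indices are shifted by one against the usual convention: the \<open>n\<close>-th convergent is
  \<open>cf_num b (n + 1) / cf_den b (n + 1)\<close>, and index \<open>0\<close> stands for the formal convergent \<open>1/0\<close>.\<close>
fun cf_num :: "(nat \<Rightarrow> int) \<Rightarrow> nat \<Rightarrow> int" where
  "cf_num b 0 = 1"
| "cf_num b (Suc 0) = b 0"
| "cf_num b (Suc (Suc n)) = b (Suc n) * cf_num b (Suc n) + cf_num b n"

fun cf_den :: "(nat \<Rightarrow> int) \<Rightarrow> nat \<Rightarrow> int" where
  "cf_den b 0 = 0"
| "cf_den b (Suc 0) = 1"
| "cf_den b (Suc (Suc n)) = b (Suc n) * cf_den b (Suc n) + cf_den b n"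

text \<open>\<open>cf_val\<close> unfolds at the first digit, but \<open>cf_num\<close> and
  \<open>cf_den\<close> unfold at the last. This lemma and the next reconcile the two
  recursions.\<close>

lemma cf_den_shift: "cf_den b (Suc n) = cf_num (\<lambda>i. b (Suc i)) n"
  by (induction n rule: induct_nat_012) auto

lemma cf_num_shift: "cf_num b (Suc n) = b 0 * cf_num (\<lambda>i. b (Suc i)) n + cf_den (\<lambda>i. b (Suc i)) n"
  by (induction n rule: induct_nat_012) (auto simp: algebra_simps)

lemma cf_num_pos: "(\<And>i. 0 < b i) \<Longrightarrow> 0 < cf_num b n"
  by (induction n rule: induct_nat_012) (auto intro: add_pos_pos)

text \<open>Positivity of the digits after \<open>b 0\<close> keeps every inner denominator nonzero;
  the integer part \<open>b 0\<close> may have any sign.\<close>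

lemma cf_val_eq:
  "(\<And>i. 0 < b (Suc i)) \<Longrightarrow> cf_val b n = of_int (cf_num b (Suc n)) / of_int (cf_den b (Suc n))"
proof (induction n arbitrary: b)
  case (Suc n)
  then have IH: "cf_val (\<lambda>i. b (Suc i)) n
      = of_int (cf_num (\<lambda>i. b (Suc i)) (Suc n)) / of_int (cf_den (\<lambda>i. b (Suc i)) (Suc n))" by simp
  have "0 < cf_num (\<lambda>i. b (Suc i)) (Suc n)" by (rule cf_num_pos) (rule Suc.prems)
  then show ?case unfolding cf_val.simps IH cf_den_shift[of b] cf_num_shift[of b]
    by (simp add: field_simps)
qed simp

lemma cf_det: "cf_num b (Suc n) * cf_den b n - cf_num b n * cf_den b (Suc n) = - ((-1) ^ n)"
  by (induction n) (simp_all add: algebra_simps)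

text \<open>Irrationality keeps the expansion from terminating: no \<open>frac (cf_rem x n)\<close>
  vanishes, so \<open>cf_rem\<close> never divides by zero.\<close>

locale irrational_cf =
  fixes x :: real
  assumes irrational: "x \<notin> \<rat>"
begin

abbreviation "p n \<equiv> cf_num (cf_digit x) n"
abbreviation "q n \<equiv> cf_den (cf_digit x) n"

lemma cf_rem_irrational: "cf_rem x n \<notin> \<rat>"
proof (induction n)
  case (Suc n)
  have "cf_rem x n = of_int \<lfloor>cf_rem x n\<rfloor> + 1 / (1 / frac (cf_rem x n))"
    by (simp add: frac_def)
  with Suc show ?case by (metis Rats_add Rats_divide Rats_of_int Rats_1 cf_rem.simps(2))
qed (use irrational in simp)

lemma frac_cf_rem: "0 < frac (cf_rem x n)" "frac (cf_rem x n) < 1"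
  using cf_rem_irrational[of n] frac_lt_1 Ints_subset_Rats by (auto simp: frac_gt_0_iff)

lemma cf_rem_gt_1: "1 < cf_rem x (Suc n)"
  using frac_cf_rem by simp

lemma cf_rem_step: "cf_rem x n = of_int (cf_digit x n) + 1 / cf_rem x (Suc n)"
  by (simp add: cf_digit_def frac_def)

lemma cf_digit_le: "of_int (cf_digit x n) \<le> cf_rem x n"
  by (simp add: cf_digit_def)

lemma cf_digit_pos: "0 < cf_digit x (Suc n)"
  using cf_rem_gt_1[of n] unfolding cf_digit_def by linarith

lemma cf_conv_eq: "cf_conv x n = of_int (p (Suc n)) / of_int (q (Suc n))"
  unfolding cf_conv_def by (intro cf_val_eq cf_digit_pos)

lemma cf_den_Suc_pos: "0 < q (Suc n)"
  unfolding cf_den_shift by (intro cf_num_pos cf_digit_pos)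

lemma cf_den_nonneg: "0 \<le> q n"
  using cf_den_Suc_pos by (cases n) (auto simp: less_imp_le)

lemma cf_den_add_le: "q (Suc n) + q n \<le> q (Suc (Suc n))"
  using cf_digit_pos[of n] cf_den_Suc_pos[of n] by simp

lemma cf_den_mono: "q n \<le> q (Suc n)"
proof (cases n)
  case (Suc m)
  show ?thesis unfolding Suc using cf_den_add_le[of m] cf_den_nonneg[of m] by linarith
qed simp

text \<open>Strictness starts at index 2, because \<open>q 1 = 1\<close> and \<open>q 2\<close> is
  the first partial quotient, which may be 1.\<close>

lemma cf_den_strict_mono: "q (Suc (Suc n)) < q (Suc (Suc (Suc n)))"
  using cf_den_add_le[of "Suc n"] cf_den_Suc_pos[of n] by linarith

text \<open>Denominators at least double every two steps; the factor 2 absorbs the base case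
  \<open>n = 1\<close>.\<close>

lemma cf_den_ge_power: "sqrt 2 ^ n \<le> 2 * real_of_int (q (Suc n))"
proof (induction n rule: less_induct)
  case (less n)
  consider "n = 0" | "n = 1" | m where "n = Suc (Suc m)"
    by (metis One_nat_def nat.exhaust)
  then show ?case
  proof cases
    case 1
    then show ?thesis by simp
  next
    case 2
    have "1 \<le> q 2" using cf_den_Suc_pos[of 1] by (simp add: numeral_2_eq_2)
    then have "2 * 1 \<le> 2 * real_of_int (q 2)" by (intro mult_left_mono) auto
    moreover have "sqrt 2 \<le> 2" by (rule real_le_lsqrt) auto
    ultimately show ?thesis using 2 by (simp add: numeral_2_eq_2)
  next
    case 3
    have "2 * q (Suc m) \<le> q (Suc n)"
      unfolding 3 using cf_den_add_le[of "Suc m"] cf_den_mono[of "Suc m"] by linarith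
    then have "2 * real_of_int (q (Suc m)) \<le> q (Suc n)" by linarith
    with less[of m] 3 show ?thesis by (simp add: power2_eq_square[symmetric] mult.assoc[symmetric])
  qed
qed

lemma cf_den_at_top: "filterlim (\<lambda>n. real_of_int (q (Suc n))) at_top sequentially"
proof -
  have "filterlim (\<lambda>n. sqrt 2 ^ n / 2) at_top sequentially"
    by real_asymp
  then show ?thesis
    by (rule filterlim_at_top_mono) (use cf_den_ge_power in \<open>auto simp: field_simps\<close>)
qed

text \<open>Denominator-free form of the statement that \<open>x\<close> is the Moebius image of its
  remainder \<open>cf_rem x (Suc n)\<close>.\<close>

lemma cf_rem_eq: "x * (q (Suc n) * cf_rem x (Suc n) + q n) = p (Suc n) * cf_rem x (Suc n) + p n"
proof (induction n)
  case 0
  have "cf_rem x (Suc 0) \<noteq> 0" using cf_rem_gt_1[of 0] by (simp del: cf_rem.simps)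
  then show ?case using cf_rem_step[of 0] by (simp add: field_simps del: cf_rem.simps(2))
next
  case (Suc n)
  define t where "t = cf_rem x (Suc (Suc n))"
  have t: "t > 1" unfolding t_def by (rule cf_rem_gt_1)
  have "cf_rem x (Suc n) = cf_digit x (Suc n) + 1 / t" unfolding t_def by (rule cf_rem_step)
  with Suc t show ?case unfolding t_def[symmetric] by (simp add: field_simps del: cf_rem.simps)
qed

text \<open>Insert the Moebius expression for \<open>x\<close>; the numerator of the difference is
  the determinant, hence of modulus 1.\<close>

lemma cf_approx: "\<bar>x - p (Suc n) / q (Suc n)\<bar> = 1 / (q (Suc n) * (q (Suc n) * cf_rem x (Suc n) + q n))"
proof -
  define t where "t = cf_rem x (Suc n)"
  have t: "t > 1" unfolding t_def by (rule cf_rem_gt_1)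
  have d: "real_of_int (q (Suc n)) * t + q n > 0"
    using cf_den_Suc_pos[of n] cf_den_nonneg[of n] t by (auto intro!: add_pos_nonneg)
  have q: "0 < real_of_int (q (Suc n))" using cf_den_Suc_pos[of n] by simp
  have x: "x = (p (Suc n) * t + p n) / (q (Suc n) * t + q n)"
    using cf_rem_eq[of n] d by (simp add: t_def field_simps)
  have "p (Suc n) * real_of_int (q n) - p n * real_of_int (q (Suc n)) = - ((-1) ^ n)"
    using cf_det[of "cf_digit x" n] by (simp flip: of_int_mult of_int_diff)
  then have "x - p (Suc n) / q (Suc n) = (-1) ^ n / (q (Suc n) * (q (Suc n) * t + q n))"
    using d q by (subst x) (simp add: field_simps)
  then show ?thesis using d q by (simp add: t_def abs_mult power_abs)
qed

lemma cf_den_Suc_le: "real_of_int (q (Suc (Suc n))) \<le> q (Suc n) * cf_rem x (Suc n) + q n"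
  using cf_digit_le[of "Suc n"] cf_den_Suc_pos[of n] by (simp add: mult.commute mult_left_mono del: cf_rem.simps)

end

section \<open>Borel--Cantelli for rational approximation\<close>

text \<open>Cauchy condensation: the condensed terms are
  \<open>(1 + n * ln 2) powr (- 1 - d)\<close>, comparable with a convergent p-series.\<close>

lemma summable_inverse_mult_log_powr:
  fixes d :: real
  assumes d: "0 < d"
  shows "summable (\<lambda>n. 1 / (real n * (1 + ln (real n)) powr (1 + d)))"
proof -
  define g where "g n = 1 / (real n * (1 + ln (real n)) powr (1 + d))" for n
  have mono: "g (Suc m) \<le> g m" if "0 < m" for m
  proof -
    have "0 \<le> ln (real m)" using that by simp
    then have "0 < 1 + ln (real m)" by linarith
    then have "0 < real m * (1 + ln (real m)) powr (1 + d)"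
      using that by (intro mult_pos_pos) auto
    moreover have "real m * (1 + ln (real m)) powr (1 + d)
        \<le> real (Suc m) * (1 + ln (real (Suc m))) powr (1 + d)"
      using that d \<open>0 < 1 + ln (real m)\<close> by (intro mult_mono powr_mono2) auto
    ultimately show ?thesis unfolding g_def by (intro frac_le) auto
  qed
  have "summable (\<lambda>n. real n powr (- 1 - d))"
    using d by (simp add: summable_real_powr_iff)
  then have S: "summable (\<lambda>n. ln 2 powr (- 1 - d) * real (Suc n) powr (- 1 - d))"
    by (intro summable_mult) (rule summable_Suc_iff[of "\<lambda>n. real n powr (- 1 - d)", THEN iffD2])
  have bound: "2 ^ n * g (2 ^ n) \<le> ln 2 powr (- 1 - d) * real (Suc n) powr (- 1 - d)" for n
  proof -
    have l2: "ln 2 \<le> (1::real)" using ln_le_minus_one[of 2] by simp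
    have "2 ^ n * g (2 ^ n) = (1 + real n * ln 2) powr (- 1 - d)"
      by (simp add: g_def ln_realpow powr_minus_divide[of _ "1 + d", simplified])
    \<comment> \<open>Here \<open>1 + n * ln 2\<close> is at least \<open>(n + 1) * ln 2\<close>,
      since \<open>ln 2 \<le> 1\<close>, and the exponent is negative.\<close>
    also have "\<dots> \<le> (ln 2 * real (Suc n)) powr (- 1 - d)"
      using d l2 by (intro powr_mono2') (auto simp: algebra_simps intro!: mult_pos_pos add_pos_nonneg)
    also have "\<dots> = ln 2 powr (- 1 - d) * real (Suc n) powr (- 1 - d)"
      by (simp add: powr_mult)
    finally show ?thesis .
  qed
  have "summable (\<lambda>n. 2 ^ n * g (2 ^ n))"
    by (rule summable_comparison_test'[OF S, of 0]) (use bound in \<open>auto simp: g_def abs_mult\<close>)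
  then have "summable g"
    using condensation_test[of g] mono by (simp add: g_def)
  then show ?thesis unfolding g_def .
qed

lemma AE_eventually_far_from_rationals:
  fixes \<psi> :: "nat \<Rightarrow> real"
  assumes psi: "\<And>n. 0 < n \<Longrightarrow> 1 \<le> \<psi> n" and S: "summable (\<lambda>n. 1 / (real n * \<psi> n))"
  shows "AE x in lborel. \<forall>\<^sub>F n in sequentially. \<forall>p::int.
           1 / ((real n)\<^sup>2 * \<psi> n) \<le> \<bar>x - of_int p / real n\<bar>"
proof -
  define r where "r n = 1 / ((real n)\<^sup>2 * \<psi> n)" for n
  have r0: "0 \<le> r n" for n
    using psi[of n] by (cases "n = 0") (auto simp: r_def)
  have r1: "r n \<le> 1" if "0 < n" for n
    using psi[OF that] that unfolding r_def
    by (simp add: divide_le_eq_1)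
       (metis mult_mono' mult_1 of_nat_1 of_nat_le_iff one_le_power power2_eq_square zero_le_one
          less_eq_Suc_le One_nat_def of_nat_power)
  \<comment> \<open>Over all numerators the intervals have infinite total length, so Borel-Cantelli
    is applied on each \<open>[-M, M]\<close> separately and the countably many \<open>M\<close> are
    combined afterwards.\<close>
  have "AE x in lborel. \<bar>x\<bar> \<le> real M \<longrightarrow>
      (\<forall>\<^sub>F n in sequentially. \<forall>p::int. r n \<le> \<bar>x - of_int p / real n\<bar>)" for M :: nat
  proof -
    \<comment> \<open>If \<open>\<bar>x\<bar> \<le> M\<close> and \<open>p / n\<close> is within
      \<open>r n \<le> 1\<close> of \<open>x\<close>, then
      \<open>\<bar>p\<bar> \<le> (M + 1) * n\<close>.\<close>
    define I where "I n = {- int ((M + 1) * n) .. int ((M + 1) * n)}" for n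
    define A where "A n = (\<Union>p\<in>I n. {of_int p / real n - r n <..< of_int p / real n + r n})" for n
    have meas: "A n \<in> sets lborel" for n by (simp add: A_def I_def)
    have fin: "emeasure lborel (A n) < \<infinity>" for n
      by (intro emeasure_bounded_finite) (auto simp: A_def I_def)
    have bound: "measure lborel (A n) \<le> (2 * (2 * real M + 3)) * (1 / (real n * \<psi> n))" if "0 < n" for n
    proof -
      have "measure lborel (A n) \<le> (\<Sum>p\<in>I n. measure lborel {of_int p / real n - r n <..< of_int p / real n + r n})"
        unfolding A_def by (intro measure_UNION_le) (auto simp: I_def)
      also have "\<dots> = real (card (I n)) * (2 * r n)" using r0[of n] by simp
      also have "card (I n) = 2 * (M + 1) * n + 1" by (simp add: I_def nat_add_distrib nat_mult_distrib)
      also have "real (2 * (M + 1) * n + 1) * (2 * r n) \<le> (real (2 * M + 3) * real n) * (2 * r n)"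
        using that r0[of n] by (intro mult_right_mono) (auto simp: algebra_simps)
      also have "\<dots> = (2 * (2 * real M + 3)) * (1 / (real n * \<psi> n))"
        using that by (simp add: r_def power2_eq_square)
      finally show ?thesis .
    qed
    have "summable (\<lambda>n. measure lborel (A n))"
      by (rule summable_comparison_test'[OF summable_mult[OF S, of "2 * (2 * real M + 3)"], of 1])
         (use bound in auto)
    from borel_cantelli_AE1[OF meas fin this]
    show ?thesis
    proof eventually_elim
      case (elim x)
      show ?case
      proof
        assume x: "\<bar>x\<bar> \<le> real M"
        from elim eventually_gt_at_top[of 0]
        show "\<forall>\<^sub>F n in sequentially. \<forall>p::int. r n \<le> \<bar>x - of_int p / real n\<bar>"
        proof eventually_elim
          case (elim n)
          show ?case
          proof (intro allI leI notI)
            fix p :: int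
            assume "\<bar>x - of_int p / real n\<bar> < r n"
            then have close: "\<bar>x - of_int p / real n\<bar> < r n" .
            with r1[of n] x elim have "\<bar>of_int p / real n\<bar> \<le> real (M + 1)" by auto
            then have "of_int \<bar>p\<bar> \<le> (of_int (int ((M + 1) * n)) :: real)"
              using elim by (simp add: abs_divide divide_le_eq algebra_simps)
            then have "\<bar>p\<bar> \<le> int ((M + 1) * n)" by (simp only: of_int_le_iff)
            then have "p \<in> I n" unfolding I_def abs_le_iff by simp
            with close elim show False by (auto simp: A_def)
          qed
        qed
      qed
    qed
  qed
  then have "AE x in lborel. \<forall>M::nat. \<bar>x\<bar> \<le> real M \<longrightarrow>
      (\<forall>\<^sub>F n in sequentially. \<forall>p::int. r n \<le> \<bar>x - of_int p / real n\<bar>)"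
    unfolding AE_all_countable by blast
  then show ?thesis
    unfolding r_def by eventually_elim (metis real_arch_simple)
qed

section \<open>Convergence\<close>

text \<open>Exempting \<open>[-1, 0]\<close> cuts the positive from the negative rationals.
  Translation works on each side separately, and both sides occur because the signs in
  \<open>cf_term\<close> alternate.\<close>

lemma periodic_add_nat_pos:
  fixes f :: "rat \<Rightarrow> complex"
  assumes "\<And>x::rat. \<not> (-1 \<le> x \<and> x \<le> 0) \<Longrightarrow> f x = f (x + 1)" and "0 < y"
  shows "f (y + of_nat n) = f y"
proof (induction n)
  case (Suc n)
  have "0 < y + of_nat n" using assms(2) by (intro add_pos_nonneg) auto
  then show ?case using assms(1)[of "y + of_nat n"] Suc by (simp add: add_ac)
qed simp

lemma periodic_diff_nat_neg:
  fixes f :: "rat \<Rightarrow> complex"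
  assumes "\<And>x::rat. \<not> (-1 \<le> x \<and> x \<le> 0) \<Longrightarrow> f x = f (x + 1)" and "0 < y"
  shows "f (- y - of_nat n) = f (- y)"
proof (induction n)
  case (Suc n)
  have "0 < y + of_nat n" using assms(2) by (intro add_pos_nonneg) auto
  then have "- y - of_nat (Suc n) < -1" by simp
  then show ?case using assms(1)[of "- y - of_nat (Suc n)"] Suc by simp
qed simp

context irrational_cf
begin

text \<open>For even \<open>n\<close> the argument lies in \<open>[-1, 0]\<close>, exactly where
  \<open>f x = f (x + 1)\<close> is not assumed, so it cannot be replaced by the positive
  representative. Hence only odd convergents appear in the limit.\<close>

definition cf_term :: "complex \<Rightarrow> (rat \<Rightarrow> complex) \<Rightarrow> nat \<Rightarrow> complex" where
  "cf_term k f n = of_int (q (Suc n)) powr (- k) * f (of_int ((-1) ^ Suc n * q n) / of_int (q (Suc n)))"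

text \<open>At odd index the determinant is 1, so the preceding denominator is the inverse of the
  numerator, and it already lies in the required range.\<close>

lemma fstar_term_cf_conv_odd:
  "fstar_term k f (cf_conv x (2 * j + 1)) = cf_term k f (2 * j + 1)"
proof -
  define n where "n = 2 * j + 1"
  have det: "p (Suc n) * q n - p n * q (Suc n) = 1"
    using cf_det[of "cf_digit x" n] by (simp add: n_def)
  then have "[p (Suc n) * q n = 1] (mod q (Suc n))"
    by (metis cong_iff_dvd_diff diff_eq_eq add_diff_cancel_left' dvd_triv_right)
  moreover have "coprime (p (Suc n)) (q (Suc n))"
    using det by (intro det_unit_coprime(1)[of _ "q n" "p n"]) simp
  moreover have "0 < q n" using cf_den_Suc_pos[of "2 * j"] by (simp add: n_def)
  ultimately have "fstar_term k f (of_int (p (Suc n)) / of_int (q (Suc n)))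
      = of_int (q (Suc n)) powr (- k) * f (of_int (q n) / of_int (q (Suc n)))"
    using cf_den_mono cf_den_Suc_pos by (intro fstar_term_divide)
  then show ?thesis unfolding n_def[symmetric] cf_conv_eq cf_term_def by (simp add: n_def)
qed

text \<open>Reciprocity at \<open>(-1) ^ n * q (Suc n) / q (Suc (Suc n))\<close> produces an
  argument that differs from that of \<open>cf_term k f n\<close> by a partial quotient, up to sign.
  It is removed by translation on one side of 0; \<open>0 < n\<close> keeps the argument away from
  0.\<close>

lemma cf_term_Suc_diff:
  fixes h :: "real \<Rightarrow> complex"
  assumes f_per: "\<And>x::rat. \<not> (-1 \<le> x \<and> x \<le> 0) \<Longrightarrow> f x = f (x + 1)"
    and h_rel: "\<And>x::rat. x \<noteq> 0 \<Longrightarrow>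
        h (of_rat x) = f x - (complex_of_real \<bar>of_rat x\<bar>) powr (- k) * f (- 1 / x)"
    and n: "0 < n"
  shows "cf_term k f (Suc n) - cf_term k f n
       = of_int (q (Suc (Suc n))) powr (- k) * h (of_int ((-1) ^ n * q (Suc n)) / of_int (q (Suc (Suc n))))"
proof -
  define Q1 Q2 b y where "Q1 = q (Suc n)" and "Q2 = q (Suc (Suc n))" and "b = nat (cf_digit x (Suc n))"
    and "y = (of_int (q n) / of_int Q1 :: rat)"
  have Q1: "0 < Q1" and Q2: "0 < Q2" unfolding Q1_def Q2_def by (rule cf_den_Suc_pos)+
  have y: "0 < y" using cf_den_Suc_pos[of "n - 1"] n Q1 by (simp add: y_def)
  have "Q2 = int b * Q1 + q n" using cf_digit_pos[of n] by (simp add: Q1_def Q2_def b_def)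
  then have Q2Q1: "of_int Q2 / of_int Q1 = y + of_nat b" using Q1 by (simp add: y_def field_simps)
  have "f (- of_int ((-1) ^ n * Q2) / of_int Q1) = f (of_int ((-1) ^ Suc n * q n) / of_int Q1)"
  proof (cases "even n")
    case True
    have "f (- (of_int Q2 / of_int Q1)) = f (- y)"
      using periodic_diff_nat_neg[of f, OF f_per y] by (simp add: Q2Q1)
    with True show ?thesis by (simp add: y_def)
  next
    case False
    have "f (of_int Q2 / of_int Q1) = f y"
      using periodic_add_nat_pos[of f, OF f_per y] by (simp add: Q2Q1)
    with False show ?thesis by (simp add: y_def)
  qed
  with reciprocity_scaled[of h f k, OF h_rel Q1 Q2, of "(-1) ^ n"] show ?thesis
    by (simp add: cf_term_def Q1_def Q2_def power_abs)
qed

lemma summable_cf_den_powr: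
  assumes "0 < s"
  shows "summable (\<lambda>n. real_of_int (q (Suc n)) powr (- s))"
proof -
  have bound: "real_of_int (q (Suc n)) powr (- s) \<le> 2 powr s * (sqrt 2 powr (- s)) ^ n" for n
  proof -
    have "real_of_int (q (Suc n)) powr (- s) \<le> (sqrt 2 ^ n / 2) powr (- s)"
      using cf_den_ge_power[of n] assms by (intro powr_mono2') (auto simp: field_simps)
    also have "\<dots> = 2 powr s * (sqrt 2 powr (- s)) ^ n"
    proof -
      have "(sqrt 2 ^ n) powr (- s) = (sqrt 2 powr real n) powr (- s)"
        by (subst powr_realpow) auto
      also have "\<dots> = (sqrt 2 powr (- s)) ^ n"
        unfolding powr_powr by (subst powr_power) (auto simp: mult.commute)
      finally show ?thesis unfolding powr_divide by (simp add: powr_minus divide_inverse)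
    qed
    finally show ?thesis .
  qed
  have "summable (\<lambda>n. 2 powr s * (sqrt 2 powr (- s)) ^ n)"
    using assms by (intro summable_mult summable_geometric) (simp add: powr_less_one)
  then show ?thesis
    by (rule summable_comparison_test'[where N = 0]) (use bound in simp)
qed

text \<open>The exact error of a convergent is at most
  \<open>1 / (q (Suc n) * q (Suc (Suc n)))\<close>, so a lower bound on the distance to rationals
  bounds the next denominator.\<close>

lemma cf_den_ratio_eventually_le:
  fixes \<psi> :: "nat \<Rightarrow> real"
  assumes psi: "\<And>n. 0 < n \<Longrightarrow> 1 \<le> \<psi> n"
    and far: "\<forall>\<^sub>F n in sequentially. \<forall>p::int. 1 / ((real n)\<^sup>2 * \<psi> n) \<le> \<bar>x - of_int p / real n\<bar>"
  shows "\<forall>\<^sub>F n in sequentially. real_of_int (q (Suc (Suc n))) / q (Suc n) \<le> \<psi> (nat (q (Suc n)))"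
proof -
  obtain N where N: "\<And>n p. N \<le> n \<Longrightarrow> 1 / ((real n)\<^sup>2 * \<psi> n) \<le> \<bar>x - of_int p / real n\<bar>"
    using far by (auto simp: eventually_sequentially)
  have "\<forall>\<^sub>F n in sequentially. real N \<le> real_of_int (q (Suc n))"
    using cf_den_at_top by (simp add: filterlim_at_top)
  then show ?thesis
  proof eventually_elim
    case (elim n)
    define m t where "m = nat (q (Suc n))" and "t = q (Suc n) * cf_rem x (Suc n) + q n"
    have m0: "0 < m" and mq: "real_of_int (q (Suc n)) = real m"
      using cf_den_Suc_pos[of n] by (simp_all add: m_def)
    have le: "real_of_int (q (Suc (Suc n))) \<le> t" unfolding t_def by (rule cf_den_Suc_le)
    then have t0: "0 < t" using cf_den_Suc_pos[of "Suc n"] by linarith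
    have "1 / ((real m)\<^sup>2 * \<psi> m) \<le> 1 / (real m * t)"
      using N[of m "p (Suc n)"] elim cf_approx[of n] by (simp add: mq t_def)
    then have "real m * t \<le> (real m)\<^sup>2 * \<psi> m"
      using m0 t0 psi[OF m0] by (simp add: field_simps)
    then have "t \<le> real m * \<psi> m" using m0 by (simp add: power2_eq_square mult.assoc)
    with le have "real_of_int (q (Suc (Suc n))) \<le> real m * \<psi> m" by linarith
    then show ?case unfolding mq m_def[symmetric] using m0 by (simp add: divide_le_eq mult.commute)
  qed
qed

lemma convergent_cf_term:
  fixes h :: "real \<Rightarrow> complex"
  assumes k_pos: "Re k > 0" and d: "0 < d" "d < 1"
    and f_per: "\<And>x::rat. \<not> (-1 \<le> x \<and> x \<le> 0) \<Longrightarrow> f x = f (x + 1)"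
    and h_rel: "\<And>x::rat. x \<noteq> 0 \<Longrightarrow>
        h (of_rat x) = f x - (complex_of_real \<bar>of_rat x\<bar>) powr (- k) * f (- 1 / x)"
    and h_bound: "\<And>x::real. 0 < \<bar>x\<bar> \<Longrightarrow> \<bar>x\<bar> < 1 \<Longrightarrow> norm (h x) \<le> C * exp (\<bar>x\<bar> powr (d - 1))"
    and far: "\<forall>\<^sub>F n in sequentially. \<forall>p::int.
        1 / ((real n)\<^sup>2 * (1 + ln (real n)) powr (1 + d)) \<le> \<bar>x - of_int p / real n\<bar>"
  shows "convergent (cf_term k f)"
proof -
  define \<sigma> where "\<sigma> = Re k"
  have \<sigma>: "0 < \<sigma>" using k_pos by (simp add: \<sigma>_def)
  \<comment> \<open>The ratio bound has exponent \<open>1 + d\<close> and the growth of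
    \<open>h\<close> contributes \<open>1 - d\<close>. Their product is below 1, so the argument of
    \<open>exp\<close> is \<open>o(ln Q1)\<close> and costs at most half of the decay exponent
    \<open>\<sigma>\<close>.\<close>
  define e where "e = (1 + d) * (1 - d)"
  have e: "e < 1" using d by (simp add: e_def algebra_simps)
  have "((\<lambda>y::real. (1 + y) powr e / y) \<longlongrightarrow> 0) at_top"
    using e by real_asymp
  then have "\<forall>\<^sub>F y in at_top. (1 + y) powr e / y < \<sigma> / 2"
    using \<sigma> by (intro order_tendstoD(2)) auto
  then have "\<forall>\<^sub>F y in at_top. (1 + y) powr e \<le> \<sigma> / 2 * y"
    using eventually_gt_at_top[of "0::real"] by eventually_elim (auto simp: divide_less_eq)
  moreover have "filterlim (\<lambda>n. ln (real_of_int (q (Suc n)))) at_top sequentially"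
    by (rule filterlim_compose[OF ln_at_top cf_den_at_top])
  ultimately have 1: "\<forall>\<^sub>F n in sequentially.
      (1 + ln (real_of_int (q (Suc n)))) powr e \<le> \<sigma> / 2 * ln (real_of_int (q (Suc n)))"
    by (rule eventually_compose_filterlim)
  have 2: "\<forall>\<^sub>F n in sequentially. real_of_int (q (Suc (Suc n))) / q (Suc n)
      \<le> (1 + ln (real (nat (q (Suc n))))) powr (1 + d)"
    by (rule cf_den_ratio_eventually_le[OF _ far]) (use d in \<open>auto intro!: ge_one_powr_ge_zero\<close>)
  have "\<forall>\<^sub>F n in sequentially. norm (cf_term k f (Suc n) - cf_term k f n)
      \<le> \<bar>C\<bar> * real_of_int (q (Suc n)) powr (- (\<sigma> / 2))"
    using 1 2 eventually_gt_at_top[of 0]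
  proof eventually_elim
    case (elim n)
    define Q1 Q2 where "Q1 = q (Suc n)" and "Q2 = q (Suc (Suc n))"
    define z :: real where "z = of_int ((-1) ^ n * Q1) / of_int Q2"
    have Q1: "0 < Q1" unfolding Q1_def by (rule cf_den_Suc_pos)
    \<comment> \<open>Strict inequality puts \<open>z\<close> inside the open interval on which
      \<open>h\<close> is bounded.\<close>
    have Q12: "Q1 < Q2"
      using cf_den_strict_mono[of "n - 1"] elim by (simp add: Q1_def Q2_def)
    have az: "\<bar>z\<bar> = of_int Q1 / of_int Q2" using Q1 Q12 by (simp add: z_def abs_mult power_abs)
    have ratio: "of_int Q2 / of_int Q1 \<le> (1 + ln Q1) powr (1 + d)"
      using elim(2) Q1 by (simp add: Q1_def Q2_def del: cf_den.simps)
    have "\<bar>z\<bar> powr (d - 1) = (of_int Q2 / of_int Q1) powr (1 - d)"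
      using Q1 Q12 powr_minus[of "of_int Q2 / of_int Q1 :: real" "1 - d"]
      by (simp add: az powr_divide powr_minus_divide[of _ "1 - d", simplified])
    also have "\<dots> \<le> ((1 + ln Q1) powr (1 + d)) powr (1 - d)"
      using ratio Q1 Q12 d by (intro powr_mono2) auto
    also have "\<dots> \<le> \<sigma> / 2 * ln Q1"
      using elim(1) by (simp add: powr_powr e_def Q1_def)
    finally have z: "\<bar>z\<bar> powr (d - 1) \<le> \<sigma> / 2 * ln Q1" .
    have "norm (h z) \<le> C * exp (\<bar>z\<bar> powr (d - 1))"
      by (rule h_bound) (use Q1 Q12 in \<open>auto simp: az\<close>)
    also have "\<dots> \<le> \<bar>C\<bar> * exp (\<sigma> / 2 * ln Q1)"
      using z by (intro mult_mono) auto
    also have "\<dots> = \<bar>C\<bar> * Q1 powr (\<sigma> / 2)" using Q1 by (simp add: powr_def)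
    finally have hz: "norm (h z) \<le> \<bar>C\<bar> * Q1 powr (\<sigma> / 2)" .
    have "norm (cf_term k f (Suc n) - cf_term k f n) = of_int Q2 powr (- \<sigma>) * norm (h z)"
      using cf_term_Suc_diff[of f h k, OF f_per h_rel elim(3)] Q1 Q12
      by (simp add: norm_mult norm_of_int_powr z_def Q1_def Q2_def \<sigma>_def del: cf_den.simps)
    also have "\<dots> \<le> of_int Q1 powr (- \<sigma>) * (\<bar>C\<bar> * Q1 powr (\<sigma> / 2))"
      using hz Q1 Q12 \<sigma> by (intro mult_mono powr_mono2') auto
    also have "\<dots> = \<bar>C\<bar> * (Q1 powr (- \<sigma>) * Q1 powr (\<sigma> / 2))" by simp
    also have "\<dots> = \<bar>C\<bar> * Q1 powr (- (\<sigma> / 2))" by (simp flip: powr_add)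
    finally show ?case by (simp add: Q1_def)
  qed
  then have "summable (\<lambda>n. cf_term k f (Suc n) - cf_term k f n)"
    by (rule summable_comparison_test_ev) (intro summable_mult summable_cf_den_powr, use \<sigma> in simp)
  then have "convergent (\<lambda>n. cf_term k f n - cf_term k f 0)"
    unfolding summable_iff_convergent sum_lessThan_telescope .
  then show ?thesis
    by (subst (asm) convergent_diff_const_right_iff)
qed

text \<open>The inverse Moebius map \<open>t\<close> is continuous at \<open>x\<close> and sends
  \<open>x\<close> to its remainder, which exceeds 1. Nearby rationals thus go to fractions
  \<open>u/v > 1\<close>, the form that \<open>fstar_term_chain_bound\<close> takes.\<close>

lemma rational_in_cylinder:
  assumes n: "0 < n"
  shows "\<exists>d>0. \<forall>y::rat. \<bar>of_rat y - x\<bar> < d \<longrightarrow>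
     (\<exists>u v. coprime u v \<and> 0 < v \<and> v \<le> u \<and>
        y = of_int (p (Suc n) * u + p n * v) / of_int (q (Suc n) * u + q n * v))"
proof -
  define t where "t y = (p n - y * q n) / (y * q (Suc n) - p (Suc n))" for y :: real
  have "x * q (Suc n) - p (Suc n) \<noteq> 0"
  proof
    assume "x * q (Suc n) - p (Suc n) = 0"
    then have "x = p (Suc n) / q (Suc n)" using cf_den_Suc_pos[of n] by (simp add: field_simps)
    then show False using irrational by (metis Rats_divide Rats_of_int)
  qed
  moreover from this have "t x = cf_rem x (Suc n)"
    using cf_rem_eq[of n] by (simp add: t_def field_simps del: cf_rem.simps)
  then have "1 < t x" using cf_rem_gt_1 by simp
  ultimately have "\<forall>\<^sub>F y in nhds x. 1 < t y"
    unfolding t_def by (intro order_tendstoD(1)[of _ "t x"]) (auto simp: t_def intro!: tendsto_eq_intros filterlim_ident)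
  then obtain d where d: "0 < d" "\<And>y. \<bar>y - x\<bar> < d \<Longrightarrow> 1 < t y"
    by (auto simp: eventually_nhds_metric dist_real_def)
  have "\<exists>u v. coprime u v \<and> 0 < v \<and> v \<le> u \<and>
        y = of_int (p (Suc n) * u + p n * v) / of_int (q (Suc n) * u + q n * v)"
    if y: "\<bar>of_rat y - x\<bar> < d" for y :: rat
  proof -
    define w where "w = (of_int (p n) - y * of_int (q n)) / (y * of_int (q (Suc n)) - of_int (p (Suc n)))"
    have "of_rat w = t (of_rat y)"
      by (simp add: w_def t_def of_rat_divide of_rat_diff of_rat_mult)
    with d(2)[OF y] have "(of_rat 1 :: real) < of_rat w" by simp
    then have w1: "1 < w" by (simp only: of_rat_less)
    obtain u v where uv: "quotient_of w = (u, v)" by fastforce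
    have v: "0 < v" by (rule quotient_of_denom_pos[OF uv])
    have w: "w = of_int u / of_int v" by (rule quotient_of_div[OF uv])
    have vu: "v < u" using w1 v by (simp add: w)
    have den: "0 < q (Suc n) * u + q n * v"
      using cf_den_Suc_pos[of n] cf_den_nonneg[of n] v vu by (intro add_pos_nonneg) auto
    have "y * of_int (q (Suc n)) - of_int (p (Suc n)) \<noteq> 0" using w1 by (auto simp: w_def)
    then have "(y * of_int (q (Suc n)) - of_int (p (Suc n))) * of_int u
        = (of_int (p n) - y * of_int (q n)) * of_int v"
      using v w by (simp add: w_def field_simps)
    then have "y * of_int (q (Suc n) * u + q n * v) = of_int (p (Suc n) * u + p n * v)"
      by (simp add: algebra_simps)
    then have "y = of_int (p (Suc n) * u + p n * v) / of_int (q (Suc n) * u + q n * v)"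
      using den by (metis less_irrefl nonzero_mult_div_cancel_right of_int_eq_0_iff)
    then show ?thesis using quotient_of_coprime[OF uv] v vu by (metis less_imp_le)
  qed
  with d(1) show ?thesis by blast
qed

text \<open>One odd convergent is fixed whose term is within half of \<open>\<epsilon>\<close> of
  \<open>L\<close> and whose chain bound is below the other half; every rational in its cylinder is
  then close enough.\<close>

lemma fstar_term_tendsto_on_rationals:
  fixes h :: "real \<Rightarrow> complex"
  assumes k_pos: "Re k > 0" and per: "\<And>x. f (x + 1) = f x"
    and h_rel: "\<And>x::rat. x \<noteq> 0 \<Longrightarrow>
        h (of_rat x) = f x - (complex_of_real \<bar>of_rat x\<bar>) powr (- k) * f (- 1 / x)"
    and hO: "\<And>x::real. 0 < \<bar>x\<bar> \<Longrightarrow> \<bar>x\<bar> \<le> 1 \<Longrightarrow> norm (h x) \<le> C * \<bar>x\<bar> powr (- Re k)"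
    and lim: "(\<lambda>j. fstar_term k f (cf_conv x (2 * j + 1))) \<longlonglongrightarrow> L" and \<epsilon>: "0 < \<epsilon>"
  shows "\<exists>d>0. \<forall>y::rat. \<bar>of_rat y - x\<bar> < d \<longrightarrow> norm (fstar_term k f y - L) < \<epsilon>"
proof -
  define K where "K = \<bar>C\<bar> / (1 - 2 powr (- Re k))"
  have "2 powr (- Re k) < 1" using k_pos by (simp add: powr_less_one)
  then have K: "0 \<le> K" by (simp add: K_def)
  have "(\<lambda>n. real_of_int (q (Suc n)) powr (- Re k)) \<longlonglongrightarrow> 0"
    by (rule summable_LIMSEQ_zero[OF summable_cf_den_powr[OF k_pos]])
  then have "(\<lambda>n. K * (2 * real_of_int (q (Suc n)) powr (- Re k))) \<longlonglongrightarrow> 0"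
    by (intro tendsto_mult_right_zero)
  then have "(\<lambda>j. K * (2 * real_of_int (q (Suc (2 * j + 1))) powr (- Re k))) \<longlonglongrightarrow> 0"
    by (rule LIMSEQ_subseq_LIMSEQ[unfolded o_def, where f = "\<lambda>j. 2 * j + 1"]) (auto simp: strict_mono_def)
  then have "\<forall>\<^sub>F j in sequentially. K * (2 * real_of_int (q (Suc (2 * j + 1))) powr (- Re k)) < \<epsilon> / 2"
    using \<epsilon> by (intro order_tendstoD(2)) auto
  moreover have "\<forall>\<^sub>F j in sequentially. dist (fstar_term k f (cf_conv x (2 * j + 1))) L < \<epsilon> / 2"
    using lim \<epsilon> by (intro tendstoD) auto
  ultimately obtain j where
    j: "K * (2 * real_of_int (q (Suc (2 * j + 1))) powr (- Re k)) < \<epsilon> / 2"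
       "dist (fstar_term k f (cf_conv x (2 * j + 1))) L < \<epsilon> / 2"
    using eventually_happens[OF eventually_conj] by fastforce
  define n where "n = 2 * j + 1"
  obtain d where d: "0 < d" and cyl: "\<And>y::rat. \<bar>of_rat y - x\<bar> < d \<Longrightarrow>
     \<exists>u v. coprime u v \<and> 0 < v \<and> v \<le> u \<and>
        y = of_int (p (Suc n) * u + p n * v) / of_int (q (Suc n) * u + q n * v)"
    using rational_in_cylinder[of n] by (auto simp: n_def)
  have "norm (fstar_term k f y - L) < \<epsilon>" if y: "\<bar>of_rat y - x\<bar> < d" for y :: rat
  proof -
    obtain u v where uv: "coprime u v" "0 < v" "v \<le> u"
      and yuv: "y = of_int (p (Suc n) * u + p n * v) / of_int (q (Suc n) * u + q n * v)"
      using cyl[OF y] by blast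
    have "norm (fstar_term k f y - fstar_term k f (cf_conv x n))
        \<le> K * (of_int (q (Suc n)) powr (- Re k) + of_int (q (Suc n) + q n) powr (- Re k))"
      unfolding yuv cf_conv_eq K_def
    proof (rule fstar_term_chain_bound[of h, OF h_rel per _ k_pos])
      fix z :: real assume "0 < \<bar>z\<bar>" "\<bar>z\<bar> \<le> 1"
      then show "norm (h z) \<le> \<bar>C\<bar> * \<bar>z\<bar> powr (- Re k)"
        by (rule order_trans[OF hO]) (auto intro: mult_right_mono)
    qed (use uv cf_den_Suc_pos cf_den_nonneg cf_den_mono in
        \<open>auto simp: cf_det power_abs simp del: cf_num.simps cf_den.simps\<close>)
    also have "\<dots> \<le> K * (2 * of_int (q (Suc n)) powr (- Re k))"
    proof -
      have "of_int (q (Suc n) + q n) powr (- Re k) \<le> (of_int (q (Suc n)) powr (- Re k) :: real)"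
        using cf_den_nonneg[of n] cf_den_Suc_pos[of n] k_pos
        by (intro powr_mono2') auto
      then show ?thesis using K by (intro mult_left_mono) auto
    qed
    also have "\<dots> < \<epsilon> / 2" using j(1) by (simp add: n_def)
    finally have "dist (fstar_term k f y) (fstar_term k f (cf_conv x n)) < \<epsilon> / 2"
      by (simp add: dist_norm)
    with j(2) have "dist (fstar_term k f y) (fstar_term k f (cf_conv x n))
        + dist L (fstar_term k f (cf_conv x n)) < \<epsilon>"
      by (simp add: n_def dist_commute)
    then show ?thesis unfolding dist_norm[symmetric] by (rule dist_triangle_lt)
  qed
  with d show ?thesis by blast
qed

end

theorem theorem1p5:
  fixes k :: complex and \<delta> :: real
    and f :: "rat \<Rightarrow> complex" and h :: "real \<Rightarrow> complex"
  assumes k_pos: "Re k > 0"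
    and delta_pos: "\<delta> > 0"
    and f_per: "\<And>x::rat. \<not> (-1 \<le> x \<and> x \<le> 0) \<Longrightarrow> f x = f (x + 1)"
    and h_rel: "\<And>x::rat. x \<noteq> 0 \<Longrightarrow>
        h (of_rat x) = f x - (complex_of_real \<bar>of_rat x\<bar>) powr (- k) * f (- 1 / x)"
    and h_bound: "\<exists>C. \<forall>x::real. 0 < \<bar>x\<bar> \<and> \<bar>x\<bar> < 1 \<longrightarrow>
        norm (h x) \<le> C * exp (\<bar>x\<bar> powr (\<delta> - 1))"
  shows "\<exists>X :: real set. (UNIV - X) \<in> null_sets lebesgue
    \<and> (\<forall>x\<in>X. convergent (\<lambda>j. fstar_term k f (cf_conv x (2 * j + 1))))
    \<and> ((\<forall>x::rat. f (x + 1) = f x)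
         \<and> (\<exists>C. \<forall>x::real. 0 < \<bar>x\<bar> \<and> \<bar>x\<bar> \<le> 1 \<longrightarrow> norm (h x) \<le> C * \<bar>x\<bar> powr (- Re k))
       \<longrightarrow> (\<forall>x \<in> X - \<rat>. \<forall>\<epsilon>>0. \<exists>d>0. \<forall>y::rat. \<bar>of_rat y - x\<bar> < d \<longrightarrow>
             norm (fstar_term k f y - lim (\<lambda>j. fstar_term k f (cf_conv x (2 * j + 1)))) < \<epsilon>))"
proof -
  \<comment> \<open>Lowering the exponent only weakens the bound for
    \<open>\<bar>x\<bar> < 1\<close> and makes \<open>1 - d\<close> positive.\<close>
  define d where "d = min \<delta> (1/2)"
  have d: "0 < d" "d < 1" "d \<le> \<delta>" using delta_pos by (auto simp: d_def)
  obtain C where C: "\<And>x::real. 0 < \<bar>x\<bar> \<Longrightarrow> \<bar>x\<bar> < 1 \<Longrightarrow> norm (h x) \<le> C * exp (\<bar>x\<bar> powr (\<delta> - 1))"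
    using h_bound by blast
  have h_bound': "norm (h x) \<le> \<bar>C\<bar> * exp (\<bar>x\<bar> powr (d - 1))" if "0 < \<bar>x\<bar>" "\<bar>x\<bar> < 1" for x
  proof -
    have "\<bar>x\<bar> powr (\<delta> - 1) \<le> \<bar>x\<bar> powr (d - 1)" using that d by (intro powr_mono') auto
    then show ?thesis by (intro order_trans[OF C[OF that]] mult_mono) auto
  qed
  define far where "far x \<longleftrightarrow> (\<forall>\<^sub>F n in sequentially. \<forall>p::int.
      1 / ((real n)\<^sup>2 * (1 + ln (real n)) powr (1 + d)) \<le> \<bar>x - of_int p / real n\<bar>)" for x
  define X where "X = {x. x \<notin> \<rat> \<and> far x}"
  have "AE x in lborel. far x"
    unfolding far_def
    by (intro AE_eventually_far_from_rationals summable_inverse_mult_log_powr d)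
       (use d in \<open>auto intro!: ge_one_powr_ge_zero\<close>)
  moreover have "AE x in lborel. x \<notin> (\<rat> :: real set)"
    by (intro AE_not_in countable_imp_null_set_lborel countable_rat)
  ultimately have "AE x in lborel. x \<in> X" by eventually_elim (simp add: X_def)
  \<comment> \<open>Measurability of \<open>X\<close> is not established directly: its complement
    sits inside a Borel null set, and Lebesgue measure is complete.\<close>
  then obtain N where "N \<in> null_sets lborel" "UNIV - X \<subseteq> N"
    by (auto simp: eventually_ae_filter)
  then have null: "UNIV - X \<in> null_sets lebesgue"
    by (auto simp: null_sets_completion_iff2)
  have conv: "convergent (\<lambda>j. fstar_term k f (cf_conv x (2 * j + 1)))" if "x \<in> X" for x
  proof -
    interpret irrational_cf x using that by unfold_locales (simp add: X_def)
    have "convergent (cf_term k f)"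
      by (rule convergent_cf_term[of k d f h, OF k_pos d(1,2) f_per h_rel h_bound'])
         (use that in \<open>auto simp: X_def far_def\<close>)
    then have "convergent (cf_term k f \<circ> (\<lambda>j. 2 * j + 1))"
      by (rule convergent_subseq_convergent) (auto simp: strict_mono_def)
    then show ?thesis by (simp add: o_def fstar_term_cf_conv_odd[simplified])
  qed
  show ?thesis
  proof (rule exI[of _ X], intro conjI ballI impI allI)
    fix x and \<epsilon> :: real
    assume x: "x \<in> X - \<rat>" and \<epsilon>: "0 < \<epsilon>"
      and asm: "(\<forall>x. f (x + 1) = f x) \<and>
        (\<exists>C. \<forall>x::real. 0 < \<bar>x\<bar> \<and> \<bar>x\<bar> \<le> 1 \<longrightarrow> norm (h x) \<le> C * \<bar>x\<bar> powr (- Re k))"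
    from asm obtain B where
      B: "\<And>x::real. 0 < \<bar>x\<bar> \<Longrightarrow> \<bar>x\<bar> \<le> 1 \<Longrightarrow> norm (h x) \<le> B * \<bar>x\<bar> powr (- Re k)" by blast
    from asm have per: "f (x + 1) = f x" for x by simp
    interpret irrational_cf x using x by unfold_locales simp
    show "\<exists>d>0. \<forall>y::rat. \<bar>of_rat y - x\<bar> < d \<longrightarrow>
        norm (fstar_term k f y - lim (\<lambda>j. fstar_term k f (cf_conv x (2 * j + 1)))) < \<epsilon>"
      using conv[of x] x
      by (intro fstar_term_tendsto_on_rationals[of k f h B, OF k_pos per h_rel B _ \<epsilon>])
         (auto simp: convergent_LIMSEQ_iff)
  qed (use null conv in auto)
qed

end
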